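(* For a knot $K$ and an integer $i$, let $\mathfrak{u}_i(K)$ be the maximal $G$-torsion order of $\mathrm{CBN}(K)$ in homological grading $i$. Then for all knots $K$ and $J$, $$\max_{i\in\mathbb{Z}}|\mathfrak{u}_i(K)-\mathfrak{u}_i(J)|\leq\lambda(K,J).$$
   Context: Knots are smooth knots in $S^3$. Gradings. $\mathbb{Z}[G]$ is the polynomial ring in one variable, with quantum grading $q(1)=0$, $q(G)=-2$. Complexes are bigraded; differentials raise the homological degree by $1$ and preserve the quantum degree. The complex $\mathrm{CBN}(K)$. It is, up to chain homotopy equivalence of graded complexes of free $\mathbb{Z}[G]$-modules, the reduced Khovanov complex for the Frobenius algebra $A=\mathbb{Z}[G][X]/(X^2+GX)$. Concretely: take an oriented diagram $D$ of $K$ with $n_\pm$ positive/negative crossings and a basepoint away from the crossings. To a vertex $v$ of the cube of resolutions (Khovanov's conventions for $0$- and $1$-smoothings) assign the tensor product over $\mathbb{Z}[G]$ of one copy of $A$ for each circle without basepoint ($1$ in degree $+1$, $X$ in degree $-1$) and $A/(X)\cong\mathbb{Z}[G]$ (generator $1$ in degree $0$) for the circle with basepoint, placed in homological degree $|v|-n_-$ and shifted in quantum degree by $|v|+n_+-2n_-$. Edge maps are, up to the usual signs, induced by multiplication $m$ (merge) and by $\Delta(1)=1\otimes X+X\otimes 1+G\,1\otimes 1$, $\Delta(X)=X\otimes X$ (split). Torsion. For an element $a$ of a $\mathbb{Z}[G]$-module, $\mathrm{ord}_G(a)=\min\{n\in\mathbb{Z}_{\ge0}\mid G^n a=0\}$;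 $a$ is $G$-torsion if $\mathrm{ord}_G(a)<\infty$. $\mathfrak{u}_i(K)$ is the maximum of $\mathrm{ord}_G(a)$ over all $G$-torsion elements $a$ of the homology $H_i(\mathrm{CBN}(K))$ in homological degree $i$. Chain maps are $\mathbb{Z}[G]$-linear, commute with differentials and preserve the homological grading; a chain map $f$ is homogeneous of quantum degree $q(f)$ if it shifts quantum degree by $q(f)$; $\simeq$ between maps is chain homotopy. Definition. $\lambda(K,J)$ is the minimal integer $n\ge 0$ such that there exist homogeneous chain maps $f\colon\mathrm{CBN}(K)\to\mathrm{CBN}(J)$ and $g\colon\mathrm{CBN}(J)\to\mathrm{CBN}(K)$ with $f\circ g\simeq G^n\cdot\mathrm{id}$ and $g\circ f\simeq G^n\cdot\mathrm{id}$ (with $\min\varnothing=\infty$). *)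

theory Defs
  imports
    "HOL-Analysis.Analysis"
    "HOL-Algebra.AbelCoset"
    "HOL-Algebra.Module"
    "HOL-Computational_Algebra.Polynomial"
    "HOL-Library.Extended_Nat"
begin

section \<open>Smooth knots in the 3-sphere\<close>

definition smooth_curve :: "(real \<Rightarrow> 'a::real_normed_vector) \<Rightarrow> bool" where
  "smooth_curve \<gamma> \<longleftrightarrow>
     (\<exists>\<gamma>' :: nat \<Rightarrow> real \<Rightarrow> 'a. \<gamma>' 0 = \<gamma> \<and>
        (\<forall>k t. (\<gamma>' k has_vector_derivative \<gamma>' (Suc k) t) (at t)))"

text \<open>In \<open>smooth_surface\<close>, \<open>P i j\<close> is the mixed partial derivative of order \<open>i\<close> in the first and
  \<open>j\<close> in the second variable.\<close>

definition smooth_surface :: "(real \<times> real \<Rightarrow> 'a::real_normed_vector) \<Rightarrow> bool" where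
  "smooth_surface F \<longleftrightarrow>
     (\<exists>P :: nat \<Rightarrow> nat \<Rightarrow> real \<times> real \<Rightarrow> 'a. P 0 0 = F \<and>
        (\<forall>i j. continuous_on UNIV (P i j)) \<and>
        (\<forall>i j s t. ((\<lambda>x. P i j (x, t)) has_vector_derivative P (Suc i) j (s, t)) (at s)) \<and>
        (\<forall>i j s t. ((\<lambda>y. P i j (s, y)) has_vector_derivative P i (Suc j) (s, t)) (at t)))"

text \<open>Smooth embeddings of the circle \<open>\<real>/\<int>\<close> into the unit sphere of \<open>\<real>\<^sup>4\<close>.\<close>

definition knot_param :: "(real \<Rightarrow> real ^ 4) \<Rightarrow> bool" where
  "knot_param \<gamma> \<longleftrightarrow> smooth_curve \<gamma> \<and> (\<forall>t. \<gamma> t \<in> sphere 0 1) \<and>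
     (\<forall>s t. \<gamma> s = \<gamma> t \<longleftrightarrow> s - t \<in> \<int>) \<and> (\<forall>t. vector_derivative \<gamma> (at t) \<noteq> 0)"

definition smooth_knot :: "(real ^ 4) set \<Rightarrow> bool" where
  "smooth_knot K \<longleftrightarrow> (\<exists>\<gamma>. knot_param \<gamma> \<and> K = range \<gamma>)"

definition knot_isotopic :: "(real ^ 4) set \<Rightarrow> (real ^ 4) set \<Rightarrow> bool" where
  "knot_isotopic K K' \<longleftrightarrow>
     (\<exists>F. smooth_surface F \<and> (\<forall>s\<in>{0..1}. knot_param (\<lambda>t. F (s, t))) \<and>
        K = range (\<lambda>t. F (0, t)) \<and> K' = range (\<lambda>t. F (1, t)))"


section \<open>Knot diagrams\<close>

text \<open>
  A diagram with \<open>n\<close> crossings is recorded by its signed Gauss code. Travelling once around the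
  oriented knot one meets the crossings \<open>2n\<close> times, at the positions \<open>0, \<dots>, 2n - 1\<close>; a crossing is
  given by the position of its over-strand, the position of its under-strand, and its sign. Arc \<open>k\<close>
  of the diagram runs from position \<open>k\<close> to position \<open>k + 1\<close> modulo \<open>2n\<close>. A diagram without
  crossings has the single closed arc \<open>0\<close>. The basepoint lies in the interior of the arc \<open>base\<close>.
  The order of the list of crossings only serves to fix the signs in the cube of resolutions.
\<close>

record crossing =
  over :: nat
  under :: nat
  positive :: bool

record knot_diagram =
  crossings :: "crossing list"
  base :: nat

definition ncr :: "knot_diagram \<Rightarrow> nat" where
  "ncr D = length (crossings D)"

definition n_plus :: "knot_diagram \<Rightarrow> nat" where
  "n_plus D = length (filter positive (crossings D))"

definition n_minus :: "knot_diagram \<Rightarrow> nat" where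
  "n_minus D = length (filter (\<lambda>c. \<not> positive c) (crossings D))"

definition arcs :: "knot_diagram \<Rightarrow> nat set" where
  "arcs D = {..<max 1 (2 * ncr D)}"

text \<open>Stereographic projection from the north pole \<open>(0, 0, 0, 1)\<close>, which preserves orientation for
  the boundary orientation of the sphere. Diagrams are obtained by forgetting the third coordinate
  and are viewed from above.\<close>

definition stereographic :: "real ^ 4 \<Rightarrow> real ^ 3" where
  "stereographic x = vector [x $ 1 / (1 - x $ 4), x $ 2 / (1 - x $ 4), x $ 3 / (1 - x $ 4)]"

definition planar :: "real ^ 3 \<Rightarrow> real ^ 2" where
  "planar y = vector [y $ 1, y $ 2]"

text \<open>
  \<open>D\<close> is read off from the projection of \<open>\<gamma>\<close>: \<open>\<tau> k\<close> is the parameter at position \<open>k\<close>. As each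
  position occurs in just one crossing, the equivalence describing the double points excludes triple
  points; the nonvanishing determinants say that the double points are transverse.
\<close>

definition projects_to :: "(real \<Rightarrow> real ^ 4) \<Rightarrow> knot_diagram \<Rightarrow> bool" where
  "projects_to \<gamma> D \<longleftrightarrow>
     (let c = (\<lambda>t. planar (stereographic (\<gamma> t)));
          h = (\<lambda>t. stereographic (\<gamma> t) $ 3);
          c' = (\<lambda>t. vector_derivative c (at t));
          ps = map over (crossings D) @ map under (crossings D)
      in (\<forall>t. \<gamma> t $ 4 \<noteq> 1) \<and> (\<forall>t. c' t \<noteq> 0) \<and>
         distinct ps \<and> set ps = {..<2 * ncr D} \<and> base D \<in> arcs D \<and>
         (\<exists>\<tau> :: nat \<Rightarrow> real.
            strict_mono_on {..<2 * ncr D} \<tau> \<and> \<tau> ` {..<2 * ncr D} \<subseteq> {0..<1} \<and>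
            (\<forall>s\<in>{0..<1}. \<forall>t\<in>{0..<1}.
               c s = c t \<and> h s > h t \<longleftrightarrow>
               (\<exists>x\<in>set (crossings D). s = \<tau> (over x) \<and> t = \<tau> (under x))) \<and>
            (\<forall>x\<in>set (crossings D).
               let \<delta> = det (vector [c' (\<tau> (over x)), c' (\<tau> (under x))] :: real ^ 2 ^ 2)
               in if positive x then \<delta> > 0 else \<delta> < 0)))"

definition diagram_of :: "knot_diagram \<Rightarrow> (real ^ 4) set \<Rightarrow> bool" where
  "diagram_of D K \<longleftrightarrow>
     (\<exists>\<gamma>. knot_param \<gamma> \<and> knot_isotopic K (range \<gamma>) \<and> projects_to \<gamma> D)"


section \<open>Modules over \<open>\<int>[G]\<close> and torsion orders\<close>

definition ZG :: "int poly ring" where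
  "ZG = \<lparr>carrier = UNIV, monoid.mult = (*), one = 1, zero = 0, add = (+)\<rparr>"

definition varG :: "int poly" where
  "varG = [:0, 1:]"

text \<open>The free module on a finite set \<open>B\<close>. Multiplication and unit of the underlying ring record
  are irrelevant for modules.\<close>

definition free_ZG :: "'b set \<Rightarrow> (int poly, 'b \<Rightarrow> int poly) module" where
  "free_ZG B = \<lparr>carrier = {x. \<forall>b. b \<notin> B \<longrightarrow> x b = 0}, monoid.mult = undefined, one = undefined,
     zero = (\<lambda>_. 0), add = (\<lambda>x y b. x b + y b), smult = (\<lambda>p x b. p * x b)\<rparr>"

definition linear_maps ::
  "(int poly, 'c) module \<Rightarrow> (int poly, 'd) module \<Rightarrow> ('c \<Rightarrow> 'd) set" where
  "linear_maps M N = {f \<in> carrier M \<rightarrow> carrier N.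
     (\<forall>x\<in>carrier M. \<forall>y\<in>carrier M. f (x \<oplus>\<^bsub>M\<^esub> y) = f x \<oplus>\<^bsub>N\<^esub> f y) \<and>
     (\<forall>p\<in>carrier ZG. \<forall>x\<in>carrier M. f (p \<odot>\<^bsub>M\<^esub> x) = p \<odot>\<^bsub>N\<^esub> f x)}"

definition ord_G :: "(int poly, 'c) module \<Rightarrow> 'c \<Rightarrow> enat" where
  "ord_G M a = Inf {enat n | n. varG ^ n \<odot>\<^bsub>M\<^esub> a = \<zero>\<^bsub>M\<^esub>}"

definition G_torsion :: "(int poly, 'c) module \<Rightarrow> 'c set" where
  "G_torsion M = {a \<in> carrier M. ord_G M a < \<infinity>}"

definition max_torsion_order :: "(int poly, 'c) module \<Rightarrow> nat" where
  "max_torsion_order M = Max {the_enat (ord_G M a) | a. a \<in> G_torsion M}"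


section \<open>Bigraded complexes\<close>

text \<open>\<open>homog C i q\<close> is the set of elements of homological degree \<open>i\<close> which are homogeneous of
  quantum degree \<open>q\<close>.\<close>

record 'c bigraded_complex =
  cmod :: "int \<Rightarrow> (int poly, 'c) module"
  cdiff :: "int \<Rightarrow> 'c \<Rightarrow> 'c"
  homog :: "int \<Rightarrow> int \<Rightarrow> 'c set"

definition cycles :: "'c bigraded_complex \<Rightarrow> int \<Rightarrow> 'c set" where
  "cycles C i = a_kernel (cmod C i) (cmod C (i + 1)) (cdiff C i)"

definition boundaries :: "'c bigraded_complex \<Rightarrow> int \<Rightarrow> 'c set" where
  "boundaries C i = cdiff C (i - 1) ` carrier (cmod C (i - 1))"

definition homology :: "'c bigraded_complex \<Rightarrow> int \<Rightarrow> (int poly, 'c set) module" where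
  "homology C i = (let M = cmod C i; B = boundaries C i in
     \<lparr>carrier = (\<lambda>z. B +>\<^bsub>M\<^esub> z) ` cycles C i, monoid.mult = undefined, one = undefined,
      zero = B, add = (\<lambda>X Y. X <+>\<^bsub>M\<^esub> Y),
      smult = (\<lambda>p X. B <+>\<^bsub>M\<^esub> ((\<lambda>x. p \<odot>\<^bsub>M\<^esub> x) ` X))\<rparr>)"

definition chain_map ::
  "'c bigraded_complex \<Rightarrow> 'd bigraded_complex \<Rightarrow> (int \<Rightarrow> 'c \<Rightarrow> 'd) \<Rightarrow> bool" where
  "chain_map C C' f \<longleftrightarrow>
     (\<forall>i. f i \<in> linear_maps (cmod C i) (cmod C' i)) \<and>
     (\<forall>i. \<forall>x\<in>carrier (cmod C i). f (i + 1) (cdiff C i x) = cdiff C' i (f i x))"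

definition homogeneous_of_degree ::
  "'c bigraded_complex \<Rightarrow> 'd bigraded_complex \<Rightarrow> (int \<Rightarrow> 'c \<Rightarrow> 'd) \<Rightarrow> int \<Rightarrow> bool" where
  "homogeneous_of_degree C C' f s \<longleftrightarrow> (\<forall>i q. f i ` homog C i q \<subseteq> homog C' i (q + s))"

definition homogeneous_chain_map ::
  "'c bigraded_complex \<Rightarrow> 'd bigraded_complex \<Rightarrow> (int \<Rightarrow> 'c \<Rightarrow> 'd) \<Rightarrow> bool" where
  "homogeneous_chain_map C C' f \<longleftrightarrow> chain_map C C' f \<and> (\<exists>s. homogeneous_of_degree C C' f s)"

definition chain_homotopic ::
  "'c bigraded_complex \<Rightarrow> 'd bigraded_complex \<Rightarrow>
     (int \<Rightarrow> 'c \<Rightarrow> 'd) \<Rightarrow> (int \<Rightarrow> 'c \<Rightarrow> 'd) \<Rightarrow> bool" where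
  "chain_homotopic C C' f g \<longleftrightarrow>
     (\<exists>h. (\<forall>i. h i \<in> linear_maps (cmod C i) (cmod C' (i - 1))) \<and>
        (\<forall>i. \<forall>x\<in>carrier (cmod C i).
           f i x = g i x \<oplus>\<^bsub>cmod C' i\<^esub>
             (cdiff C' (i - 1) (h i x) \<oplus>\<^bsub>cmod C' i\<^esub> h (i + 1) (cdiff C i x))))"

definition G_power :: "'c bigraded_complex \<Rightarrow> nat \<Rightarrow> int \<Rightarrow> 'c \<Rightarrow> 'c" where
  "G_power C n i x = varG ^ n \<odot>\<^bsub>cmod C i\<^esub> x"

definition lambda_dist :: "'c bigraded_complex \<Rightarrow> 'd bigraded_complex \<Rightarrow> enat" where
  "lambda_dist C C' = Inf {enat n | n. \<exists>f g.
     homogeneous_chain_map C C' f \<and> homogeneous_chain_map C' C g \<and>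
     chain_homotopic C' C' (\<lambda>i. f i \<circ> g i) (G_power C' n) \<and>
     chain_homotopic C C (\<lambda>i. g i \<circ> f i) (G_power C n)}"


section \<open>The reduced complex\<close>

text \<open>
  A vertex of the cube is the set \<open>v \<subseteq> {..<ncr D}\<close> of the crossings that are 1-smoothed. The strand
  at position \<open>a\<close> enters along arc \<open>prev_arc D a\<close> and leaves along arc \<open>a\<close>. The oriented smoothing
  is the 0-smoothing of a positive and the 1-smoothing of a negative crossing; it joins each
  incoming arc to the outgoing arc of the other strand. The other smoothing joins the two incoming
  arcs and the two outgoing arcs. A circle of the resolution is identified with its set of arcs.
\<close>

definition prev_arc :: "knot_diagram \<Rightarrow> nat \<Rightarrow> nat" where
  "prev_arc D a = (a + 2 * ncr D - 1) mod (2 * ncr D)"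

definition joins :: "knot_diagram \<Rightarrow> nat set \<Rightarrow> (nat \<times> nat) set" where
  "joins D v = (\<Union>i<ncr D.
     let x = crossings D ! i; a = over x; b = under x in
     if i \<in> v \<longleftrightarrow> \<not> positive x
     then {(prev_arc D a, b), (prev_arc D b, a)}
     else {(prev_arc D a, prev_arc D b), (a, b)})"

definition connected_arcs :: "knot_diagram \<Rightarrow> nat set \<Rightarrow> (nat \<times> nat) set" where
  "connected_arcs D v = Restr ((joins D v \<union> (joins D v)\<inverse>)\<^sup>*) (arcs D)"

definition circles :: "knot_diagram \<Rightarrow> nat set \<Rightarrow> nat set set" where
  "circles D v = arcs D // connected_arcs D v"

definition base_circle :: "knot_diagram \<Rightarrow> nat set \<Rightarrow> nat set" where
  "base_circle D v = connected_arcs D v `` {base D}"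

text \<open>
  The tensor products of copies of \<open>A\<close>, one for each circle without basepoint, and of
  \<open>A/(X)\<close> for the circle with basepoint have as basis the tensor products of the elements
  \<open>1\<close> and \<open>X\<close>: the generator \<open>(v, S)\<close> carries \<open>X\<close> on the circles in \<open>S\<close> and \<open>1\<close> on all others.
\<close>

type_synonym state = "nat set \<times> nat set set"

definition states :: "knot_diagram \<Rightarrow> state set" where
  "states D = {(v, S). v \<subseteq> {..<ncr D} \<and> S \<subseteq> circles D v - {base_circle D v}}"

definition hdeg :: "knot_diagram \<Rightarrow> state \<Rightarrow> int" where
  "hdeg D = (\<lambda>(v, S). int (card v) - int (n_minus D))"

definition qdeg :: "knot_diagram \<Rightarrow> state \<Rightarrow> int" where
  "qdeg D = (\<lambda>(v, S).
     int (card (circles D v - {base_circle D v} - S)) - int (card S)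
     + int (card v) + int (n_plus D) - 2 * int (n_minus D))"

text \<open>
  Matrix entries of \<open>m\<close> and \<open>\<Delta>\<close> in the bases of tensor products of \<open>1\<close> and \<open>X\<close>. Both maps are
  symmetric in the tensor factors, so an entry only depends on the number \<open>k\<close> of factors \<open>X\<close> in the
  source and the number \<open>l\<close> of factors \<open>X\<close> in the target:
  \<open>m(1 \<otimes> 1) = 1\<close>, \<open>m(1 \<otimes> X) = m(X \<otimes> 1) = X\<close>, \<open>m(X \<otimes> X) = - G X\<close>;
  \<open>\<Delta>(1) = 1 \<otimes> X + X \<otimes> 1 + G 1 \<otimes> 1\<close>, \<open>\<Delta>(X) = X \<otimes> X\<close>.
\<close>

definition merge_entry :: "nat \<Rightarrow> nat \<Rightarrow> int poly" where
  "merge_entry k l =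
     (if (k, l) = (0, 0) \<or> (k, l) = (1, 1) then 1 else if (k, l) = (2, 1) then - varG else 0)"

definition split_entry :: "nat \<Rightarrow> nat \<Rightarrow> int poly" where
  "split_entry k l =
     (if (k, l) = (0, 1) \<or> (k, l) = (1, 2) then 1 else if (k, l) = (0, 0) then varG else 0)"

text \<open>
  Matrix entry, up to sign, of the edge map from \<open>(v, S)\<close> to \<open>(w, T)\<close>. The circles away from the changed
  crossing are those common to \<open>v\<close> and \<open>w\<close>; their labels have to agree. Using these entries
  only between elements of \<open>states D\<close> amounts to setting \<open>X = 0\<close> on the circle with basepoint.
\<close>

definition edge_entry :: "knot_diagram \<Rightarrow> state \<Rightarrow> state \<Rightarrow> int poly" where
  "edge_entry D = (\<lambda>(v, S) (w, T).
     let old = circles D v - circles D w; new = circles D w - circles D v;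
         k = card (S \<inter> old); l = card (T \<inter> new)
     in if S - old \<noteq> T - new then 0
        else if card old = 2 \<and> card new = 1 then merge_entry k l
        else if card old = 1 \<and> card new = 2 then split_entry k l
        else 0)"

definition diff_entry :: "knot_diagram \<Rightarrow> state \<Rightarrow> state \<Rightarrow> int poly" where
  "diff_entry D a b =
     (\<Sum>j | j < ncr D \<and> j \<notin> fst a \<and> fst b = insert j (fst a).
        (- 1) ^ card {i \<in> fst a. i < j} * edge_entry D a b)"

definition CBN :: "knot_diagram \<Rightarrow> (state \<Rightarrow> int poly) bigraded_complex" where
  "CBN D = (let gens = (\<lambda>i. {a \<in> states D. hdeg D a = i}) in
     \<lparr>cmod = (\<lambda>i. free_ZG (gens i)),
      cdiff = (\<lambda>i x b. if b \<in> gens (i + 1) then \<Sum>a\<in>gens i. x a * diff_entry D a b else 0),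
      homog = (\<lambda>i q. {x \<in> carrier (free_ZG (gens i)).
         \<forall>a k. coeff (x a) k \<noteq> 0 \<longrightarrow> qdeg D a - 2 * int k = q})\<rparr>)"

definition max_G_torsion :: "knot_diagram \<Rightarrow> int \<Rightarrow> nat" where
  "max_G_torsion D i = max_torsion_order (homology (CBN D) i)"

end

theory Submission
  imports Defs
begin

text \<open>
  Let \<open>f\<close> and \<open>g\<close> be chain maps between the two complexes whose composites are homotopic to \<open>G\<^sup>n\<close>, and
  let \<open>m\<close> be the maximal torsion order of the second complex in degree \<open>i\<close>. If \<open>a\<close> is a \<open>G\<close>-torsion
  class of the first complex, then so is its image under \<open>f\<close>, hence \<open>G\<^sup>m\<close> kills that image. Applying
  \<open>g\<close>, which followed after \<open>f\<close> is multiplication by \<open>G\<^sup>n\<close> on homology, shows that \<open>G\<^bsup>m + n\<^esup>\<close> kills \<open>a\<close>.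
  Thus the maximal torsion orders differ by at most \<open>n\<close> in every degree; this is
  \<open>torsion_exponent_transfer\<close>, applied in both directions.

  For this to say something about maxima, the torsion orders in a fixed homological degree must be
  bounded. The bound comes from the quantum grading: when \<open>G\<^sup>n z = d y\<close>, all components of \<open>G\<^sup>n z\<close> have quantum degree at most some \<open>s - 2 n\<close>.
  As \<open>d\<close> preserves the quantum degree, the part of \<open>y\<close> in higher quantum degrees may be discarded,
  and what remains of \<open>y\<close> is divisible by a power of \<open>G\<close> that falls short of \<open>G\<^sup>n\<close> by an amount
  depending only on the degrees of the generators (\<open>homogeneous_matrix_torsion_bounded\<close>). That the
  differential preserves the quantum degree is read off from the matrix entries of merge and split
  maps (\<open>qdeg_edge_entry\<close>).
\<close>


section \<open>Torsion orders in the homology of complexes over \<open>\<int>[G]\<close>\<close>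

lemma cring_ZG: "cring ZG"
proof (intro cringI abelian_groupI comm_monoidI)
  fix x :: "int poly"
  assume "x \<in> carrier ZG"
  show "\<exists>y\<in>carrier ZG. y \<oplus>\<^bsub>ZG\<^esub> x = \<zero>\<^bsub>ZG\<^esub>"
    by (rule bexI[of _ "- x"]) (simp_all add: ZG_def)
qed (simp_all add: ZG_def algebra_simps)

lemma carrier_ZG [simp]: "p \<in> carrier ZG"
  by (simp add: ZG_def)

lemma mult_ZG: "p \<otimes>\<^bsub>ZG\<^esub> p' = p * p'"
  by (simp add: ZG_def)

lemma linear_maps_closed: "f \<in> linear_maps M N \<Longrightarrow> x \<in> carrier M \<Longrightarrow> f x \<in> carrier N"
  by (auto simp: linear_maps_def)

lemma linear_maps_add:
  "f \<in> linear_maps M N \<Longrightarrow> x \<in> carrier M \<Longrightarrow> y \<in> carrier M \<Longrightarrow>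
    f (x \<oplus>\<^bsub>M\<^esub> y) = f x \<oplus>\<^bsub>N\<^esub> f y"
  by (auto simp: linear_maps_def)

lemma linear_maps_smult:
  "f \<in> linear_maps M N \<Longrightarrow> x \<in> carrier M \<Longrightarrow> f (p \<odot>\<^bsub>M\<^esub> x) = p \<odot>\<^bsub>N\<^esub> f x"
  by (auto simp: linear_maps_def)

lemma linear_maps_zero:
  assumes "module ZG M" "module ZG N" "f \<in> linear_maps M N"
  shows "f \<zero>\<^bsub>M\<^esub> = \<zero>\<^bsub>N\<^esub>"
proof -
  interpret M: module ZG M by fact
  interpret N: module ZG N by fact
  have "f \<zero>\<^bsub>M\<^esub> = f (\<zero>\<^bsub>ZG\<^esub> \<odot>\<^bsub>M\<^esub> \<zero>\<^bsub>M\<^esub>)"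
    by simp
  also have "\<dots> = \<zero>\<^bsub>ZG\<^esub> \<odot>\<^bsub>N\<^esub> f \<zero>\<^bsub>M\<^esub>"
    by (rule linear_maps_smult[OF assms(3)]) simp
  also have "\<dots> = \<zero>\<^bsub>N\<^esub>"
    by (simp add: linear_maps_closed[OF assms(3)])
  finally show ?thesis .
qed

lemma mem_a_r_coset_iff: "w \<in> N +>\<^bsub>M\<^esub> z \<longleftrightarrow> (\<exists>x\<in>N. w = x \<oplus>\<^bsub>M\<^esub> z)"
  by (simp add: a_r_coset_def')

lemma mem_set_add_image_iff:
  "w \<in> N <+>\<^bsub>M\<^esub> (h ` L) \<longleftrightarrow> (\<exists>x\<in>N. \<exists>y\<in>L. w = x \<oplus>\<^bsub>M\<^esub> h y)"
  by (simp add: set_add_def')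

text \<open>Multiplying by \<open>p\<close> and then adding \<open>N\<close> is how scalars act on cosets in the homology module; as \<open>N\<close>
  absorbs \<open>p N\<close>, it is the action of the quotient module.\<close>

lemma (in module) smult_coset:
  assumes "additive_subgroup N M" and "\<And>p x. p \<in> carrier R \<Longrightarrow> x \<in> N \<Longrightarrow> p \<odot>\<^bsub>M\<^esub> x \<in> N"
    and "p \<in> carrier R" "z \<in> carrier M"
  shows "N <+>\<^bsub>M\<^esub> (\<lambda>x. p \<odot>\<^bsub>M\<^esub> x) ` (N +>\<^bsub>M\<^esub> z) = N +>\<^bsub>M\<^esub> (p \<odot>\<^bsub>M\<^esub> z)"
proof (rule Set.set_eqI)
  interpret N: additive_subgroup N M by fact
  have N: "x \<in> carrier M" if "x \<in> N" for x
    using N.a_subset that by (rule subsetD)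
  have eq: "x \<oplus>\<^bsub>M\<^esub> p \<odot>\<^bsub>M\<^esub> (y \<oplus>\<^bsub>M\<^esub> z) = (x \<oplus>\<^bsub>M\<^esub> p \<odot>\<^bsub>M\<^esub> y) \<oplus>\<^bsub>M\<^esub> p \<odot>\<^bsub>M\<^esub> z"
    if "x \<in> N" "y \<in> N" for x y
    using that assms(3,4) by (simp add: N smult_r_distr M.a_assoc)
  have bex_coset: "(\<exists>y\<in>{y. \<exists>x\<in>N. y = f x}. P y) \<longleftrightarrow> (\<exists>x\<in>N. P (f x))" for f P
    by blast
  have coset: "N +>\<^bsub>M\<^esub> z = {y. \<exists>x\<in>N. y = x \<oplus>\<^bsub>M\<^esub> z}"
    by (simp add: set_eq_iff mem_a_r_coset_iff)
  fix w
  have "w \<in> N <+>\<^bsub>M\<^esub> (\<lambda>x. p \<odot>\<^bsub>M\<^esub> x) ` (N +>\<^bsub>M\<^esub> z) \<longleftrightarrow>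
      (\<exists>x\<in>N. \<exists>y\<in>N. w = (x \<oplus>\<^bsub>M\<^esub> p \<odot>\<^bsub>M\<^esub> y) \<oplus>\<^bsub>M\<^esub> p \<odot>\<^bsub>M\<^esub> z)"
    unfolding mem_set_add_image_iff coset bex_coset
    by (intro bex_cong refl) (simp only: eq)
  also have "\<dots> \<longleftrightarrow> (\<exists>x\<in>N. w = x \<oplus>\<^bsub>M\<^esub> p \<odot>\<^bsub>M\<^esub> z)"
  proof
    assume "\<exists>x\<in>N. \<exists>y\<in>N. w = (x \<oplus>\<^bsub>M\<^esub> p \<odot>\<^bsub>M\<^esub> y) \<oplus>\<^bsub>M\<^esub> p \<odot>\<^bsub>M\<^esub> z"
    then obtain x y where xy: "x \<in> N" "y \<in> N" and w: "w = (x \<oplus>\<^bsub>M\<^esub> p \<odot>\<^bsub>M\<^esub> y) \<oplus>\<^bsub>M\<^esub> p \<odot>\<^bsub>M\<^esub> z"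
      by (elim bexE)
    from xy have "x \<oplus>\<^bsub>M\<^esub> p \<odot>\<^bsub>M\<^esub> y \<in> N"
      by (intro N.a_closed assms(2,3))
    with w show "\<exists>x\<in>N. w = x \<oplus>\<^bsub>M\<^esub> p \<odot>\<^bsub>M\<^esub> z"
      by (rule bexI)
  next
    assume "\<exists>x\<in>N. w = x \<oplus>\<^bsub>M\<^esub> p \<odot>\<^bsub>M\<^esub> z"
    then obtain x where x: "x \<in> N" and w: "w = x \<oplus>\<^bsub>M\<^esub> p \<odot>\<^bsub>M\<^esub> z"
      by (elim bexE)
    have "w = (x \<oplus>\<^bsub>M\<^esub> p \<odot>\<^bsub>M\<^esub> \<zero>\<^bsub>M\<^esub>) \<oplus>\<^bsub>M\<^esub> p \<odot>\<^bsub>M\<^esub> z"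
      using w x assms(3) by (simp add: N)
    then have "\<exists>y\<in>N. w = (x \<oplus>\<^bsub>M\<^esub> p \<odot>\<^bsub>M\<^esub> y) \<oplus>\<^bsub>M\<^esub> p \<odot>\<^bsub>M\<^esub> z"
      using N.zero_closed by (rule bexI)
    then show "\<exists>x\<in>N. \<exists>y\<in>N. w = (x \<oplus>\<^bsub>M\<^esub> p \<odot>\<^bsub>M\<^esub> y) \<oplus>\<^bsub>M\<^esub> p \<odot>\<^bsub>M\<^esub> z"
      using x by (rule bexI)
  qed
  finally show "w \<in> N <+>\<^bsub>M\<^esub> (\<lambda>x. p \<odot>\<^bsub>M\<^esub> x) ` (N +>\<^bsub>M\<^esub> z) \<longleftrightarrow> w \<in> N +>\<^bsub>M\<^esub> (p \<odot>\<^bsub>M\<^esub> z)"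
    unfolding mem_a_r_coset_iff .
qed

lemma Inf_enat_mem:
  fixes S :: "enat set"
  assumes "S \<noteq> {}"
  shows "Inf S \<in> S"
proof -
  from assms obtain x where "x \<in> S" by blast
  then have "(LEAST x. x \<in> S) \<in> S" by (rule LeastI)
  with assms show ?thesis by (simp add: Inf_enat_def)
qed

lemma Max_the_enat_le_iff:
  fixes f :: "'a \<Rightarrow> enat"
  assumes "z\<^sub>0 \<in> Z" "f z\<^sub>0 < \<infinity>" and bound: "\<And>z. z \<in> Z \<Longrightarrow> f z < \<infinity> \<Longrightarrow> f z \<le> enat N"
  shows "Max ((\<lambda>z. the_enat (f z)) ` {z \<in> Z. f z < \<infinity>}) \<le> m \<longleftrightarrow>
    (\<forall>z\<in>Z. \<forall>k. f z \<le> enat k \<longrightarrow> f z \<le> enat m)"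
proof -
  let ?S = "(\<lambda>z. the_enat (f z)) ` {z \<in> Z. f z < \<infinity>}"
  have "?S \<subseteq> {..N}"
    using bound by fastforce
  then have "finite ?S"
    by (rule finite_subset) simp
  moreover have "?S \<noteq> {}"
    using assms(1,2) by blast
  ultimately have "Max ?S \<le> m \<longleftrightarrow> (\<forall>s\<in>?S. s \<le> m)"
    by (rule Max_le_iff)
  also have "\<dots> \<longleftrightarrow> (\<forall>z\<in>Z. f z < \<infinity> \<longrightarrow> the_enat (f z) \<le> m)"
    by blast
  also have "\<dots> \<longleftrightarrow> (\<forall>z\<in>Z. \<forall>k. f z \<le> enat k \<longrightarrow> f z \<le> enat m)"
  proof (rule ball_cong[OF refl])
    fix z
    show "(f z < \<infinity> \<longrightarrow> the_enat (f z) \<le> m) \<longleftrightarrow> (\<forall>k. f z \<le> enat k \<longrightarrow> f z \<le> enat m)"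
      by (cases "f z") auto
  qed
  finally show ?thesis .
qed

lemma ord_G_le_iff:
  assumes "\<And>m n. m \<le> n \<Longrightarrow> varG ^ m \<odot>\<^bsub>M\<^esub> a = \<zero>\<^bsub>M\<^esub> \<Longrightarrow> varG ^ n \<odot>\<^bsub>M\<^esub> a = \<zero>\<^bsub>M\<^esub>"
  shows "ord_G M a \<le> enat n \<longleftrightarrow> varG ^ n \<odot>\<^bsub>M\<^esub> a = \<zero>\<^bsub>M\<^esub>"
proof
  assume le: "ord_G M a \<le> enat n"
  let ?S = "{enat n | n. varG ^ n \<odot>\<^bsub>M\<^esub> a = \<zero>\<^bsub>M\<^esub>}"
  have "?S \<noteq> {}"
  proof
    assume empty: "?S = {}"
    have "ord_G M a = \<infinity>"
      unfolding ord_G_def empty by (simp add: top_enat_def)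
    with le show False by simp
  qed
  then have "Inf ?S \<in> ?S" by (rule Inf_enat_mem)
  then obtain j where j: "ord_G M a = enat j" "varG ^ j \<odot>\<^bsub>M\<^esub> a = \<zero>\<^bsub>M\<^esub>"
    unfolding ord_G_def by blast
  with le have "j \<le> n" by simp
  then show "varG ^ n \<odot>\<^bsub>M\<^esub> a = \<zero>\<^bsub>M\<^esub>"
    using j(2) by (rule assms)
next
  assume "varG ^ n \<odot>\<^bsub>M\<^esub> a = \<zero>\<^bsub>M\<^esub>"
  then show "ord_G M a \<le> enat n"
    unfolding ord_G_def by (intro Inf_lower) blast
qed

text \<open>\<open>G\<^sup>m\<close> annihilates the \<open>G\<close>-torsion of the homology in degree \<open>i\<close>. Speaking of cycles and boundaries
  instead of classes lets chain maps and homotopies be applied directly.\<close>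

definition torsion_exponent :: "'c bigraded_complex \<Rightarrow> int \<Rightarrow> nat \<Rightarrow> bool" where
  "torsion_exponent C i m \<longleftrightarrow>
     (\<forall>z\<in>cycles C i. \<forall>k. varG ^ k \<odot>\<^bsub>cmod C i\<^esub> z \<in> boundaries C i \<longrightarrow>
        varG ^ m \<odot>\<^bsub>cmod C i\<^esub> z \<in> boundaries C i)"

locale ZG_complex =
  fixes C :: "'c bigraded_complex"
  assumes module_cmod: "module ZG (cmod C i)"
    and linear_cdiff: "cdiff C i \<in> linear_maps (cmod C i) (cmod C (i + 1))"
begin

lemma linear_cdiff_pred: "cdiff C (i - 1) \<in> linear_maps (cmod C (i - 1)) (cmod C i)"
  using linear_cdiff[of "i - 1"] by simp

lemma boundaries_subset: "boundaries C i \<subseteq> carrier (cmod C i)"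
  using linear_maps_closed[OF linear_cdiff_pred] by (auto simp: boundaries_def)

lemma boundaries_add:
  assumes "x \<in> boundaries C i" "y \<in> boundaries C i"
  shows "x \<oplus>\<^bsub>cmod C i\<^esub> y \<in> boundaries C i"
proof -
  interpret M: module ZG "cmod C (i - 1)" by (rule module_cmod)
  from assms obtain u v where uv: "u \<in> carrier (cmod C (i - 1))" "v \<in> carrier (cmod C (i - 1))"
    "x = cdiff C (i - 1) u" "y = cdiff C (i - 1) v"
    by (auto simp: boundaries_def)
  then have "x \<oplus>\<^bsub>cmod C i\<^esub> y = cdiff C (i - 1) (u \<oplus>\<^bsub>cmod C (i - 1)\<^esub> v)"
    by (simp add: linear_maps_add[OF linear_cdiff_pred])
  with uv show ?thesis by (simp add: boundaries_def)
qed

lemma boundaries_smult: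
  assumes "x \<in> boundaries C i"
  shows "p \<odot>\<^bsub>cmod C i\<^esub> x \<in> boundaries C i"
proof -
  interpret M: module ZG "cmod C (i - 1)" by (rule module_cmod)
  from assms obtain u where u: "u \<in> carrier (cmod C (i - 1))" "x = cdiff C (i - 1) u"
    by (auto simp: boundaries_def)
  then have "p \<odot>\<^bsub>cmod C i\<^esub> x = cdiff C (i - 1) (p \<odot>\<^bsub>cmod C (i - 1)\<^esub> u)"
    by (simp add: linear_maps_smult[OF linear_cdiff_pred])
  with u show ?thesis by (simp add: boundaries_def)
qed

lemma boundaries_minus:
  assumes "x \<in> boundaries C i"
  shows "\<ominus>\<^bsub>cmod C i\<^esub> x \<in> boundaries C i"
proof -
  interpret N: module ZG "cmod C i" by (rule module_cmod)
  have "x \<in> carrier (cmod C i)" using assms boundaries_subset by blast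
  then have "\<ominus>\<^bsub>cmod C i\<^esub> x = (\<ominus>\<^bsub>ZG\<^esub> \<one>\<^bsub>ZG\<^esub>) \<odot>\<^bsub>cmod C i\<^esub> x"
    using N.smult_l_minus[of "\<one>\<^bsub>ZG\<^esub>" x] by simp
  with boundaries_smult[OF assms] show ?thesis by simp
qed

lemma zero_boundary: "\<zero>\<^bsub>cmod C i\<^esub> \<in> boundaries C i"
  using linear_maps_zero[OF module_cmod module_cmod linear_cdiff_pred]
    abelian_monoid.zero_closed[OF abelian_group.axioms(1)[OF module.axioms(2)[OF module_cmod]]]
  unfolding boundaries_def by (metis imageI)

lemma additive_subgroup_boundaries: "additive_subgroup (boundaries C i) (cmod C i)"
proof -
  interpret N: module ZG "cmod C i" by (rule module_cmod)
  show ?thesis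
    by (intro additive_subgroupI N.add.subgroupI boundaries_subset)
      (use zero_boundary in \<open>auto simp: boundaries_add boundaries_minus\<close>)
qed

lemma cycles_iff:
  "z \<in> cycles C i \<longleftrightarrow> z \<in> carrier (cmod C i) \<and> cdiff C i z = \<zero>\<^bsub>cmod C (i + 1)\<^esub>"
  by (auto simp: cycles_def a_kernel_def')

lemma zero_cycle: "\<zero>\<^bsub>cmod C i\<^esub> \<in> cycles C i"
  using linear_maps_zero[OF module_cmod module_cmod linear_cdiff] zero_boundary boundaries_subset
  by (auto simp: cycles_iff)

lemma boundaries_power_mono:
  assumes "z \<in> carrier (cmod C i)" "varG ^ m \<odot>\<^bsub>cmod C i\<^esub> z \<in> boundaries C i" "m \<le> n"
  shows "varG ^ n \<odot>\<^bsub>cmod C i\<^esub> z \<in> boundaries C i"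
proof -
  interpret N: module ZG "cmod C i" by (rule module_cmod)
  have "varG ^ n = varG ^ (n - m) \<otimes>\<^bsub>ZG\<^esub> varG ^ m"
    using assms(3) by (simp add: ZG_def flip: power_add)
  then have "varG ^ n \<odot>\<^bsub>cmod C i\<^esub> z = varG ^ (n - m) \<odot>\<^bsub>cmod C i\<^esub> (varG ^ m \<odot>\<^bsub>cmod C i\<^esub> z)"
    using assms(1) by (simp add: N.smult_assoc1)
  with boundaries_smult[OF assms(2)] show ?thesis by simp
qed

lemma homology_smult_eq_zero_iff:
  assumes "z \<in> carrier (cmod C i)"
  shows "p \<odot>\<^bsub>homology C i\<^esub> (boundaries C i +>\<^bsub>cmod C i\<^esub> z) = \<zero>\<^bsub>homology C i\<^esub> \<longleftrightarrow>
    p \<odot>\<^bsub>cmod C i\<^esub> z \<in> boundaries C i"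
proof -
  interpret N: module ZG "cmod C i" by (rule module_cmod)
  interpret B: additive_subgroup "boundaries C i" "cmod C i"
    by (rule additive_subgroup_boundaries)
  have cl: "p \<odot>\<^bsub>homology C i\<^esub> (boundaries C i +>\<^bsub>cmod C i\<^esub> z) =
      boundaries C i +>\<^bsub>cmod C i\<^esub> (p \<odot>\<^bsub>cmod C i\<^esub> z)"
    using N.smult_coset[OF additive_subgroup_boundaries boundaries_smult _ assms]
    by (simp add: homology_def Let_def)
  have zero: "\<zero>\<^bsub>homology C i\<^esub> = boundaries C i"
    by (simp add: homology_def Let_def)
  have "p \<odot>\<^bsub>cmod C i\<^esub> z \<in> carrier (cmod C i)"
    using assms by simp
  then have "boundaries C i +>\<^bsub>cmod C i\<^esub> (p \<odot>\<^bsub>cmod C i\<^esub> z) = boundaries C i \<longleftrightarrow>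
      p \<odot>\<^bsub>cmod C i\<^esub> z \<in> boundaries C i"
    by (metis N.a_coset_join1 N.a_coset_join2 B.a_subgroup)
  then show ?thesis by (simp only: cl zero)
qed

lemma ord_G_homology_le_iff:
  assumes "z \<in> carrier (cmod C i)"
  shows "ord_G (homology C i) (boundaries C i +>\<^bsub>cmod C i\<^esub> z) \<le> enat n \<longleftrightarrow>
    varG ^ n \<odot>\<^bsub>cmod C i\<^esub> z \<in> boundaries C i"
proof -
  have "ord_G (homology C i) (boundaries C i +>\<^bsub>cmod C i\<^esub> z) \<le> enat n \<longleftrightarrow>
      varG ^ n \<odot>\<^bsub>homology C i\<^esub> (boundaries C i +>\<^bsub>cmod C i\<^esub> z) = \<zero>\<^bsub>homology C i\<^esub>"
  proof (rule ord_G_le_iff)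
    fix m n :: nat
    assume le: "m \<le> n"
      and m: "varG ^ m \<odot>\<^bsub>homology C i\<^esub> (boundaries C i +>\<^bsub>cmod C i\<^esub> z) = \<zero>\<^bsub>homology C i\<^esub>"
    from m have "varG ^ m \<odot>\<^bsub>cmod C i\<^esub> z \<in> boundaries C i"
      by (rule iffD1[OF homology_smult_eq_zero_iff[OF assms]])
    then have "varG ^ n \<odot>\<^bsub>cmod C i\<^esub> z \<in> boundaries C i"
      using le by (rule boundaries_power_mono[OF assms])
    then show "varG ^ n \<odot>\<^bsub>homology C i\<^esub> (boundaries C i +>\<^bsub>cmod C i\<^esub> z) = \<zero>\<^bsub>homology C i\<^esub>"
      by (rule iffD2[OF homology_smult_eq_zero_iff[OF assms]])
  qed
  also have "\<dots> \<longleftrightarrow> varG ^ n \<odot>\<^bsub>cmod C i\<^esub> z \<in> boundaries C i"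
    by (rule homology_smult_eq_zero_iff[OF assms])
  finally show ?thesis .
qed

text \<open>Some bound \<open>N\<close> is assumed because \<open>Max\<close> is the actual maximum only for a finite set of orders.\<close>

lemma max_torsion_order_le_iff:
  assumes "torsion_exponent C i N"
  shows "max_torsion_order (homology C i) \<le> m \<longleftrightarrow> torsion_exponent C i m"
proof -
  define \<omega> where "\<omega> z = ord_G (homology C i) (boundaries C i +>\<^bsub>cmod C i\<^esub> z)" for z
  have \<omega>: "\<omega> z \<le> enat n \<longleftrightarrow> varG ^ n \<odot>\<^bsub>cmod C i\<^esub> z \<in> boundaries C i" if "z \<in> cycles C i" for z n
    unfolding \<omega>_def using that by (intro ord_G_homology_le_iff) (simp add: cycles_iff)
  have exponent: "torsion_exponent C i n \<longleftrightarrow>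
      (\<forall>z\<in>cycles C i. \<forall>k. \<omega> z \<le> enat k \<longrightarrow> \<omega> z \<le> enat n)" for n
    unfolding torsion_exponent_def by (simp only: \<omega> cong: ball_cong)
  have torsion: "G_torsion (homology C i) =
      {a \<in> (\<lambda>z. boundaries C i +>\<^bsub>cmod C i\<^esub> z) ` cycles C i. ord_G (homology C i) a < \<infinity>}"
    by (simp add: G_torsion_def homology_def Let_def)
  have image: "{the_enat (h a) | a. a \<in> {a \<in> c ` Z. h a < \<infinity>}} =
      (\<lambda>z. the_enat (h (c z))) ` {z \<in> Z. h (c z) < \<infinity>}"
    for h :: "'c set \<Rightarrow> enat" and c and Z :: "'c set"
    by blast
  have orders: "{the_enat (ord_G (homology C i) a) | a. a \<in> G_torsion (homology C i)} =
      (\<lambda>z. the_enat (\<omega> z)) ` {z \<in> cycles C i. \<omega> z < \<infinity>}"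
    unfolding \<omega>_def torsion by (rule image)
  have "\<omega> \<zero>\<^bsub>cmod C i\<^esub> \<le> enat 0"
    unfolding \<omega>[OF zero_cycle] by (rule boundaries_smult[OF zero_boundary])
  then have "\<omega> \<zero>\<^bsub>cmod C i\<^esub> < \<infinity>"
    by (rule order_le_less_trans) simp
  moreover have "\<omega> z \<le> enat N" if "z \<in> cycles C i" "\<omega> z < \<infinity>" for z
    using that assms unfolding exponent by (metis less_infinityE order.refl)
  ultimately show ?thesis
    unfolding max_torsion_order_def orders exponent
    using zero_cycle by (intro Max_the_enat_le_iff)
qed

end

lemma chain_map_linear: "chain_map C C' f \<Longrightarrow> f i \<in> linear_maps (cmod C i) (cmod C' i)"
  unfolding chain_map_def by (elim conjE) (erule spec)

lemma chain_map_commutes: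
  assumes "chain_map C C' f" "x \<in> carrier (cmod C i)"
  shows "f (i + 1) (cdiff C i x) = cdiff C' i (f i x)"
proof -
  have "\<forall>i. \<forall>x\<in>carrier (cmod C i). f (i + 1) (cdiff C i x) = cdiff C' i (f i x)"
    using assms(1) unfolding chain_map_def by (rule conjunct2)
  from bspec[OF spec[OF this] assms(2)] show ?thesis .
qed

lemma chain_map_boundary:
  assumes f: "chain_map C C' f" and x: "x \<in> boundaries C i"
  shows "f i x \<in> boundaries C' i"
proof -
  from x obtain y where y: "y \<in> carrier (cmod C (i - 1))" and xy: "x = cdiff C (i - 1) y"
    unfolding boundaries_def by (rule imageE)
  have "f i x = cdiff C' (i - 1) (f (i - 1) y)"
    using chain_map_commutes[OF f y] by (simp add: xy)
  moreover have "f (i - 1) y \<in> carrier (cmod C' (i - 1))"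
    by (rule linear_maps_closed[OF chain_map_linear[OF f] y])
  ultimately show ?thesis
    unfolding boundaries_def by (rule image_eqI)
qed

text \<open>Up to the boundary of \<open>h z\<close>, a cycle \<open>z\<close> satisfies \<open>g (f z) = G\<^sup>n z\<close>. If \<open>z\<close> represents a torsion class,
  then so does \<open>f z\<close>, so that \<open>G\<^sup>m f z\<close> is a boundary, and with it \<open>G\<^sup>m g (f z)\<close>.\<close>

lemma torsion_exponent_transfer:
  assumes "ZG_complex C" and "ZG_complex C'"
    and f: "chain_map C C' f" and g: "chain_map C' C g"
    and htpy: "chain_homotopic C C (\<lambda>i. g i \<circ> f i) (G_power C n)"
    and m: "torsion_exponent C' i m"
  shows "torsion_exponent C i (m + n)"
  unfolding torsion_exponent_def
proof (intro ballI allI impI)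
  interpret C: ZG_complex C by fact
  interpret C': ZG_complex C' by fact
  interpret M: module ZG "cmod C i" by (rule C.module_cmod)
  note f_lin = chain_map_linear[OF f] and g_lin = chain_map_linear[OF g]
  fix z k
  assume z: "z \<in> cycles C i" and k: "varG ^ k \<odot>\<^bsub>cmod C i\<^esub> z \<in> boundaries C i"
  from z have zc: "z \<in> carrier (cmod C i)" and dz: "cdiff C i z = \<zero>\<^bsub>cmod C (i + 1)\<^esub>"
    by (simp_all add: C.cycles_iff)
  have fz: "f i z \<in> carrier (cmod C' i)"
    by (rule linear_maps_closed[OF f_lin zc])
  have "cdiff C' i (f i z) = f (i + 1) (cdiff C i z)"
    by (rule chain_map_commutes[OF f zc, symmetric])
  also have "\<dots> = \<zero>\<^bsub>cmod C' (i + 1)\<^esub>"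
    unfolding dz by (rule linear_maps_zero[OF C.module_cmod C'.module_cmod f_lin])
  finally have "f i z \<in> cycles C' i"
    using fz by (simp add: C'.cycles_iff)
  moreover have "varG ^ k \<odot>\<^bsub>cmod C' i\<^esub> f i z \<in> boundaries C' i"
    using chain_map_boundary[OF f k] by (simp add: linear_maps_smult[OF f_lin zc])
  ultimately have "varG ^ m \<odot>\<^bsub>cmod C' i\<^esub> f i z \<in> boundaries C' i"
    using m by (auto simp: torsion_exponent_def)
  from chain_map_boundary[OF g this]
  have gf: "varG ^ m \<odot>\<^bsub>cmod C i\<^esub> g i (f i z) \<in> boundaries C i"
    by (simp add: linear_maps_smult[OF g_lin fz])
  obtain h where h_lin: "\<forall>i. h i \<in> linear_maps (cmod C i) (cmod C (i - 1))"
    and h: "\<forall>i. \<forall>x\<in>carrier (cmod C i). g i (f i x) = varG ^ n \<odot>\<^bsub>cmod C i\<^esub> x \<oplus>\<^bsub>cmod C i\<^esub>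
             (cdiff C (i - 1) (h i x) \<oplus>\<^bsub>cmod C i\<^esub> h (i + 1) (cdiff C i x))"
    using htpy unfolding chain_homotopic_def G_power_def o_def by (elim exE conjE)
  let ?b = "cdiff C (i - 1) (h i z)"
  have b: "?b \<in> boundaries C i"
    unfolding boundaries_def by (intro imageI linear_maps_closed[OF spec[OF h_lin] zc])
  then have bc: "?b \<in> carrier (cmod C i)"
    by (rule subsetD[OF C.boundaries_subset])
  have "h (i + 1) (cdiff C i z) = \<zero>\<^bsub>cmod C i\<^esub>"
    unfolding dz
    using linear_maps_zero[OF C.module_cmod C.module_cmod spec[OF h_lin, of "i + 1"]] by simp
  with bspec[OF spec[OF h] zc] bc have "g i (f i z) = varG ^ n \<odot>\<^bsub>cmod C i\<^esub> z \<oplus>\<^bsub>cmod C i\<^esub> ?b"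
    by simp
  then have "varG ^ m \<odot>\<^bsub>cmod C i\<^esub> g i (f i z) =
      varG ^ m \<odot>\<^bsub>cmod C i\<^esub> (varG ^ n \<odot>\<^bsub>cmod C i\<^esub> z) \<oplus>\<^bsub>cmod C i\<^esub> varG ^ m \<odot>\<^bsub>cmod C i\<^esub> ?b"
    using zc bc by (simp only: M.smult_r_distr M.smult_closed carrier_ZG)
  moreover have "varG ^ m \<odot>\<^bsub>cmod C i\<^esub> (varG ^ n \<odot>\<^bsub>cmod C i\<^esub> z) = varG ^ (m + n) \<odot>\<^bsub>cmod C i\<^esub> z"
    using M.smult_assoc1[OF carrier_ZG carrier_ZG zc, of "varG ^ m" "varG ^ n"]
    by (simp add: mult_ZG power_add)
  ultimately have "varG ^ m \<odot>\<^bsub>cmod C i\<^esub> g i (f i z) =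
      varG ^ (m + n) \<odot>\<^bsub>cmod C i\<^esub> z \<oplus>\<^bsub>cmod C i\<^esub> varG ^ m \<odot>\<^bsub>cmod C i\<^esub> ?b"
    by simp
  then have "varG ^ (m + n) \<odot>\<^bsub>cmod C i\<^esub> z =
      varG ^ m \<odot>\<^bsub>cmod C i\<^esub> g i (f i z) \<oplus>\<^bsub>cmod C i\<^esub> \<ominus>\<^bsub>cmod C i\<^esub> (varG ^ m \<odot>\<^bsub>cmod C i\<^esub> ?b)"
    by (simp only: M.a_assoc M.r_neg M.r_zero M.smult_closed M.a_inv_closed carrier_ZG zc bc)
  moreover have "\<dots> \<in> boundaries C i"
    by (rule C.boundaries_add[OF gf C.boundaries_minus[OF C.boundaries_smult[OF b]]])
  ultimately show "varG ^ (m + n) \<odot>\<^bsub>cmod C i\<^esub> z \<in> boundaries C i"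
    by (rule ssubst)
qed


section \<open>Bounded torsion for matrices that preserve a grading\<close>

text \<open>If \<open>p\<close> is the coefficient of a generator of quantum degree \<open>q\<close>, the monomial \<open>G\<^sup>k\<close> in \<open>p\<close> contributes
  in quantum degree \<open>q - 2 k\<close>. Truncation keeps the contributions of quantum degree at most \<open>T\<close>, that is,
  those with \<open>k\<close> at least the ceiling of \<open>(q - T) / 2\<close>.\<close>

definition trunc :: "int \<Rightarrow> int \<Rightarrow> int poly \<Rightarrow> int poly" where
  "trunc T q p = p - poly_cutoff (nat ((q - T + 1) div 2)) p"

lemma coeff_trunc: "coeff (trunc T q p) k = (if q - 2 * int k \<le> T then coeff p k else 0)"
proof -
  have "k < nat ((q - T + 1) div 2) \<longleftrightarrow> \<not> q - 2 * int k \<le> T"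
    by linarith
  then show ?thesis
    by (simp add: trunc_def coeff_poly_cutoff)
qed

lemma trunc_sum: "trunc T q (sum f A) = (\<Sum>a\<in>A. trunc T q (f a))"
  by (rule poly_eqI) (simp add: coeff_trunc coeff_sum)

text \<open>Truncation at a fixed quantum degree commutes with a matrix that preserves the quantum degree,
  because each entry takes the part of \<open>p\<close> in a given degree to that same degree.\<close>

lemma trunc_mult_homogeneous:
  assumes "\<And>k. coeff e k \<noteq> 0 \<Longrightarrow> q' - 2 * int k = q"
  shows "trunc T q' (p * e) = trunc T q p * e"
proof (rule poly_eqI)
  fix n
  have "coeff (trunc T q p) i * coeff e (n - i) =
      (if q' - 2 * int n \<le> T then coeff p i * coeff e (n - i) else 0)" if "i \<le> n" for i
  proof (cases "coeff e (n - i) = 0")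
    case False
    with assms[of "n - i"] that have "q - 2 * int i = q' - 2 * int n"
      by (simp add: of_nat_diff)
    then show ?thesis by (simp add: coeff_trunc)
  qed simp
  then show "coeff (trunc T q' (p * e)) n = coeff (trunc T q p * e) n"
    by (simp add: coeff_trunc coeff_mult)
qed

lemma coeff_varG_power_mult: "coeff (varG ^ n * p) k = (if k < n then 0 else coeff p (k - n))"
proof -
  have "varG ^ n = monom 1 n"
    by (simp add: varG_def monom_altdef)
  then show ?thesis by (simp add: coeff_monom_mult)
qed

text \<open>The cokernel of a matrix that preserves the quantum degree has bounded \<open>G\<close>-torsion. Suppose
  \<open>G\<^sup>n z = y e\<close> with \<open>n\<close> large. The left-hand side lives in low quantum degrees only, so \<open>y\<close> may be
  replaced by its truncation to these degrees. A monomial in a low quantum degree carries a high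
  power of \<open>G\<close>, so the truncation of \<open>y\<close> is divisible by \<open>G\<^bsup>n - N\<^esup>\<close>, and this factor can be cancelled.\<close>

lemma homogeneous_matrix_torsion_bounded:
  fixes e :: "'a \<Rightarrow> 'b \<Rightarrow> int poly"
  assumes "finite A" "finite B"
    and hom: "\<And>a b k. a \<in> A \<Longrightarrow> b \<in> B \<Longrightarrow> coeff (e a b) k \<noteq> 0 \<Longrightarrow> q' b - 2 * int k = q a"
  shows "\<exists>N. \<forall>z n y. (\<forall>b\<in>B. varG ^ n * z b = (\<Sum>a\<in>A. y a * e a b)) \<longrightarrow>
    (\<exists>w. \<forall>b\<in>B. varG ^ N * z b = (\<Sum>a\<in>A. w a * e a b))"
proof -
  define s r where "s = Max (q' ` B)" and "r = Min (q ` A)"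
  have s: "q' b \<le> s" if "b \<in> B" for b
    using that \<open>finite B\<close> by (simp add: s_def)
  have r: "r \<le> q a" if "a \<in> A" for a
    using that \<open>finite A\<close> by (simp add: r_def)
  (* Any N with 2 * N >= s - r would do; this choice avoids rounding. *)
  define N where "N = nat (s - r)"
  have "\<exists>w. \<forall>b\<in>B. varG ^ N * z b = (\<Sum>a\<in>A. w a * e a b)"
    if "\<forall>b\<in>B. varG ^ n * z b = (\<Sum>a\<in>A. y a * e a b)" for z n y
  proof (cases "n \<le> N")
    note eq = bspec[OF that]
    case True
    have "varG ^ N * z b = (\<Sum>a\<in>A. (varG ^ (N - n) * y a) * e a b)" if "b \<in> B" for b
    proof -
      have "varG ^ N * z b = varG ^ (N - n) * (varG ^ n * z b)"
        using True by (simp add: mult.assoc[symmetric] flip: power_add)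
      then show ?thesis
        by (simp add: eq[OF that] sum_distrib_left mult.assoc)
    qed
    then show ?thesis
      by (intro exI[of _ "\<lambda>a. varG ^ (N - n) * y a"] ballI)
  next
    note eq = bspec[OF that]
    case False
    (* All monomials of the components of varG ^ n * z have quantum degree at most T. *)
    define T where "T = s - 2 * int n"
    define w where "w a = poly_shift (n - N) (trunc T (q a) (y a))" for a
    have trunc_y: "trunc T (q a) (y a) = varG ^ (n - N) * w a" if "a \<in> A" for a
    proof (rule poly_eqI)
      fix k
      have "\<not> q a - 2 * int k \<le> T" if "k < n - N"
        using that r[OF \<open>a \<in> A\<close>] False unfolding T_def N_def by linarith
      then show "coeff (trunc T (q a) (y a)) k = coeff (varG ^ (n - N) * w a) k"
        by (auto simp: coeff_varG_power_mult w_def coeff_poly_shift coeff_trunc)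
    qed
    have "varG ^ N * z b = (\<Sum>a\<in>A. w a * e a b)" if b: "b \<in> B" for b
    proof -
      have "trunc T (q' b) (varG ^ n * z b) = varG ^ n * z b"
        using s[OF b] by (intro poly_eqI) (auto simp: coeff_trunc coeff_varG_power_mult T_def)
      then have "varG ^ n * z b = (\<Sum>a\<in>A. trunc T (q a) (y a) * e a b)"
        using eq[OF b] hom[OF _ b]
        by (simp add: trunc_sum trunc_mult_homogeneous[where q' = "q' b"] cong: sum.cong)
      also have "\<dots> = varG ^ (n - N) * (\<Sum>a\<in>A. w a * e a b)"
        by (simp add: trunc_y sum_distrib_left mult.assoc cong: sum.cong)
      also have "varG ^ n = varG ^ (n - N) * varG ^ N"
        using False by (simp flip: power_add)
      finally show ?thesis
        by (simp add: mult.assoc varG_def)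
    qed
    then show ?thesis
      by (intro exI[of _ w] ballI)
  qed
  then show ?thesis by (intro exI[of _ N] allI impI)
qed


section \<open>The reduced complex of a diagram\<close>

lemma module_free_ZG: "module ZG (free_ZG B)"
proof (intro moduleI cring_ZG abelian_groupI)
  fix x
  assume "x \<in> carrier (free_ZG B)"
  then show "\<exists>y\<in>carrier (free_ZG B). y \<oplus>\<^bsub>free_ZG B\<^esub> x = \<zero>\<^bsub>free_ZG B\<^esub>"
    by (intro bexI[of _ "\<lambda>b. - x b"]) (auto simp: free_ZG_def)
qed (auto simp: free_ZG_def ZG_def algebra_simps)

definition gens :: "knot_diagram \<Rightarrow> int \<Rightarrow> state set" where
  "gens D i = {a \<in> states D. hdeg D a = i}"

lemma cmod_CBN: "cmod (CBN D) i = free_ZG (gens D i)"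
  by (simp add: CBN_def gens_def Let_def)

lemma cdiff_CBN:
  "cdiff (CBN D) i x b = (if b \<in> gens D (i + 1) then \<Sum>a\<in>gens D i. x a * diff_entry D a b else 0)"
  by (simp add: CBN_def gens_def Let_def)

lemma ZG_complex_CBN: "ZG_complex (CBN D)"
proof (rule ZG_complex.intro)
  show "module ZG (cmod (CBN D) i)" for i
    by (simp add: cmod_CBN module_free_ZG)
  show "cdiff (CBN D) i \<in> linear_maps (cmod (CBN D) i) (cmod (CBN D) (i + 1))" for i
    by (auto simp: linear_maps_def cmod_CBN free_ZG_def cdiff_CBN fun_eq_iff
        distrib_right sum.distrib sum_distrib_left mult.assoc)
qed

lemma finite_circles: "finite (circles D v)"
proof -
  have "circles D v \<subseteq> Pow (arcs D)"
    by (auto simp: circles_def quotient_def connected_arcs_def)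
  then show ?thesis
    by (rule finite_subset) (simp add: arcs_def)
qed

lemma finite_states: "finite (states D)"
proof -
  have "states D \<subseteq> Sigma (Pow {..<ncr D}) (\<lambda>v. Pow (circles D v))"
    by (auto simp: states_def)
  then show ?thesis
    by (rule finite_subset) (auto intro: finite_circles)
qed

lemma base_circle_in_circles: "base D \<in> arcs D \<Longrightarrow> base_circle D v \<in> circles D v"
  by (simp add: base_circle_def circles_def quotientI)

text \<open>Counting all circles, with 1 subtracted for the one with basepoint, makes the quantum degree
  comparable across an edge of the cube without asking which circle the basepoint is on.\<close>

lemma qdeg_state:
  assumes "base D \<in> arcs D" "(v, S) \<in> states D"
  shows "qdeg D (v, S) = int (card (circles D v)) - 1 - 2 * int (card S)
     + int (card v) + int (n_plus D) - 2 * int (n_minus D)"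
proof -
  let ?R = "circles D v - {base_circle D v}"
  have S: "S \<subseteq> ?R" using assms(2) by (simp add: states_def)
  have "card (circles D v) = Suc (card ?R)"
    using card.remove[OF finite_circles base_circle_in_circles[OF assms(1)]] .
  moreover have "card ?R = card S + card (?R - S)"
    using S card_Diff_subset[of S ?R] card_mono[of ?R S] finite_circles[of D v]
    by (metis finite_Diff finite_subset le_add_diff_inverse)
  ultimately show ?thesis by (simp add: qdeg_def)
qed

lemma coeff_varG: "coeff varG k = (if k = 1 then 1 else 0)"
  by (auto simp: varG_def coeff_pCons split: nat.splits)

text \<open>A merge lowers and a split raises the number of circles by one, and the circles common to both
  resolutions carry equal labels. Hence the quantum degree changes, apart from the shift by \<open>1\<close> along
  the edge, only through the labels \<open>X\<close> on the old and new circles; in each nonzero entry of the merge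
  and split matrices the power of \<open>G\<close> makes up for the difference.\<close>

lemma qdeg_edge_entry:
  assumes base: "base D \<in> arcs D" and a: "(v, S) \<in> states D" and b: "(w, T) \<in> states D"
    and card_w: "card w = Suc (card v)"
    and nz: "coeff (edge_entry D (v, S) (w, T)) k \<noteq> 0"
  shows "qdeg D (w, T) - 2 * int k = qdeg D (v, S)"
proof -
  let ?V = "circles D v" and ?W = "circles D w"
  have fin: "finite S" "finite T"
    using a b finite_circles by (auto simp: states_def intro: finite_subset)
  have labels: "S - (?V - ?W) = T - (?W - ?V)"
    using nz by (auto simp: edge_entry_def Let_def split: if_splits)
  have S: "card S = card (S \<inter> (?V - ?W)) + card (S - (?V - ?W))"
    using fin by (metis card_Int_Diff)
  have T: "card T = card (T \<inter> (?W - ?V)) + card (S - (?V - ?W))"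
    using fin labels by (metis card_Int_Diff)
  have V: "card ?V = card (?V \<inter> ?W) + card (?V - ?W)"
    by (rule card_Int_Diff[OF finite_circles])
  have W: "card ?W = card (?V \<inter> ?W) + card (?W - ?V)"
    by (metis Int_commute card_Int_Diff finite_circles)
  show ?thesis
    using nz labels S T V W
    by (auto simp: qdeg_state[OF base a] qdeg_state[OF base b] card_w edge_entry_def Let_def
        merge_entry_def split_entry_def coeff_varG split: if_splits)
qed

lemma qdeg_diff_entry:
  assumes base: "base D \<in> arcs D" and a: "a \<in> states D" and b: "b \<in> states D"
    and nz: "coeff (diff_entry D a b) k \<noteq> 0"
  shows "qdeg D b - 2 * int k = qdeg D a"
proof -
  from nz obtain j where j: "j \<notin> fst a" "fst b = insert j (fst a)"
    and nz': "coeff ((- 1) ^ card {i \<in> fst a. i < j} * edge_entry D a b) k \<noteq> 0"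
    unfolding diff_entry_def coeff_sum by (auto elim!: sum.not_neutral_contains_not_neutral)
  have "coeff (edge_entry D a b) k \<noteq> 0"
    using nz' by (cases "even (card {i \<in> fst a. i < j})") simp_all
  moreover have "fst a \<subseteq> {..<ncr D}"
    using a by (auto simp: states_def)
  then have "finite (fst a)"
    by (rule finite_subset) simp
  then have "card (fst b) = Suc (card (fst a))"
    using j by simp
  ultimately show ?thesis
    using qdeg_edge_entry[OF base, of "fst a" "snd a" "fst b" "snd b" k] a b by simp
qed

text \<open>The coefficients of a boundary are obtained from those of a chain by the matrix \<open>diff_entry D\<close>,
  which preserves the quantum degree, so its torsion is bounded.\<close>

lemma CBN_torsion_exponent:
  assumes "base D \<in> arcs D"
  shows "\<exists>N. torsion_exponent (CBN D) i N"
proof -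
  have fin: "finite (gens D i)" for i
    using finite_states by (simp add: gens_def)
  have "qdeg D b - 2 * int k = qdeg D a"
    if "a \<in> gens D (i - 1)" "b \<in> gens D i" "coeff (diff_entry D a b) k \<noteq> 0" for a b k
    using qdeg_diff_entry[OF assms _ _ that(3)] that(1,2) by (simp add: gens_def)
  from homogeneous_matrix_torsion_bounded[OF fin fin this]
  obtain N where N: "\<forall>z n y.
      (\<forall>b\<in>gens D i. varG ^ n * z b = (\<Sum>a\<in>gens D (i - 1). y a * diff_entry D a b)) \<longrightarrow>
      (\<exists>w. \<forall>b\<in>gens D i. varG ^ N * z b = (\<Sum>a\<in>gens D (i - 1). w a * diff_entry D a b))"
    by (rule exE)
  have "varG ^ N \<odot>\<^bsub>cmod (CBN D) i\<^esub> z \<in> boundaries (CBN D) i"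
    if z: "z \<in> cycles (CBN D) i" and n: "varG ^ n \<odot>\<^bsub>cmod (CBN D) i\<^esub> z \<in> boundaries (CBN D) i" for z n
  proof -
    have zero: "z b = 0" if "b \<notin> gens D i" for b
      using z that
      by (simp add: ZG_complex.cycles_iff[OF ZG_complex_CBN] cmod_CBN free_ZG_def
          del: split_paired_All)
    from n obtain y where "varG ^ n \<odot>\<^bsub>cmod (CBN D) i\<^esub> z = cdiff (CBN D) (i - 1) y"
      by (auto simp: boundaries_def)
    then have "varG ^ n * z b = cdiff (CBN D) (i - 1) y b" for b
      by (simp add: cmod_CBN free_ZG_def fun_eq_iff del: split_paired_All)
    then have "\<forall>b\<in>gens D i. varG ^ n * z b = (\<Sum>a\<in>gens D (i - 1). y a * diff_entry D a b)"
      by (simp add: cdiff_CBN)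
    from mp[OF spec[OF spec[OF spec[OF N]]] this]
    obtain w where w: "\<forall>b\<in>gens D i.
        varG ^ N * z b = (\<Sum>a\<in>gens D (i - 1). w a * diff_entry D a b)"
      by (rule exE)
    (* w is arbitrary off the generators, whereas a chain has to vanish there. *)
    define w' where "w' a = (if a \<in> gens D (i - 1) then w a else 0)" for a
    have "varG ^ N \<odot>\<^bsub>cmod (CBN D) i\<^esub> z = cdiff (CBN D) (i - 1) w'"
      using w zero by (auto simp: cmod_CBN free_ZG_def cdiff_CBN w'_def fun_eq_iff
          simp del: split_paired_All)
    moreover have "w' \<in> carrier (cmod (CBN D) (i - 1))"
      by (simp add: cmod_CBN free_ZG_def w'_def)
    ultimately show ?thesis by (simp add: boundaries_def)
  qed
  then show ?thesis by (auto simp: torsion_exponent_def)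
qed

lemma diagram_of_base: "diagram_of D K \<Longrightarrow> base D \<in> arcs D"
  by (auto simp: diagram_of_def projects_to_def Let_def)

lemma max_G_torsion_le_add:
  assumes "base D \<in> arcs D" "base E \<in> arcs E"
    and "chain_map (CBN D) (CBN E) f" "chain_map (CBN E) (CBN D) g"
    and "chain_homotopic (CBN D) (CBN D) (\<lambda>i. g i \<circ> f i) (G_power (CBN D) n)"
  shows "max_G_torsion D i \<le> max_G_torsion E i + n"
proof -
  interpret D: ZG_complex "CBN D" by (rule ZG_complex_CBN)
  interpret E: ZG_complex "CBN E" by (rule ZG_complex_CBN)
  obtain N N' where N: "torsion_exponent (CBN D) i N" "torsion_exponent (CBN E) i N'"
    using CBN_torsion_exponent assms(1,2) by blast
  have "torsion_exponent (CBN E) i (max_G_torsion E i)"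
    unfolding max_G_torsion_def
    by (rule iffD1[OF E.max_torsion_order_le_iff[OF N(2)] order_refl])
  then have "torsion_exponent (CBN D) i (max_G_torsion E i + n)"
    by (rule torsion_exponent_transfer[OF ZG_complex_CBN ZG_complex_CBN assms(3-5)])
  then show ?thesis
    unfolding max_G_torsion_def[of D] by (rule iffD2[OF D.max_torsion_order_le_iff[OF N(1)]])
qed

theorem proposition1p3:
  fixes K J :: "(real ^ 4) set" and D E :: knot_diagram
  assumes "smooth_knot K" and "smooth_knot J"
    and "diagram_of D K" and "diagram_of E J"
  shows "enat (MAX i::int. nat \<bar>int (max_G_torsion D i) - int (max_G_torsion E i)\<bar>)
           \<le> lambda_dist (CBN D) (CBN E)"
  unfolding lambda_dist_def
proof (rule Inf_greatest)
  fix x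
  assume "x \<in> {enat n | n. \<exists>f g.
     homogeneous_chain_map (CBN D) (CBN E) f \<and> homogeneous_chain_map (CBN E) (CBN D) g \<and>
     chain_homotopic (CBN E) (CBN E) (\<lambda>i. f i \<circ> g i) (G_power (CBN E) n) \<and>
     chain_homotopic (CBN D) (CBN D) (\<lambda>i. g i \<circ> f i) (G_power (CBN D) n)}"
  then obtain n f g where x: "x = enat n"
    and fg: "chain_map (CBN D) (CBN E) f" "chain_map (CBN E) (CBN D) g"
      "chain_homotopic (CBN E) (CBN E) (\<lambda>i. f i \<circ> g i) (G_power (CBN E) n)"
      "chain_homotopic (CBN D) (CBN D) (\<lambda>i. g i \<circ> f i) (G_power (CBN D) n)"
    by (auto simp: homogeneous_chain_map_def)
  note base = diagram_of_base[OF assms(3)] diagram_of_base[OF assms(4)]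
  let ?u = "\<lambda>i. nat \<bar>int (max_G_torsion D i) - int (max_G_torsion E i)\<bar>"
  have le: "?u i \<le> n" for i
    using max_G_torsion_le_add[OF base fg(1,2,4), of i]
      max_G_torsion_le_add[OF base(2,1) fg(2,1,3), of i] by linarith
  (* The maximum runs over infinitely many degrees, but the bound leaves finitely many values. *)
  then have "finite (range ?u)"
    by (auto intro: finite_subset[of _ "{..n}"])
  with le show "enat (Max (range ?u)) \<le> x"
    by (simp add: x)
qed

end
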